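(* Suppose the graph is strongly connected with at least one directed spanning tree and that $\mathbf A-c\lambda_p\mathbf B\mathbf K$ is Hurwitz for all $p=2,\dots,N$. Then the multi-agent system $$\dot{\mathbf x}(t)=(\mathbf I_N\otimes \mathbf A)\mathbf x(t)-c(\mathbf L\otimes \mathbf B\mathbf K)\mathbf x(t)$$ is stable independent of unitary phase perturbations $\boldsymbol\Delta_p$ in the feedback path if and only if $$\bar\sigma(\mathbf G_p(j\omega_p))<1\quad\text{for all }\omega_p>0\text{ and all }p=2,\dots,N.$$
   Context: $\mathbf L\in\mathbb R^{N\times N}$ is the Laplacian ($l_{ii}=\sum_{k\ne i}a_{ik}$, $l_{ik}=-a_{ik}$, with nonnegative edge weights $a_{ik}$) of a weighted directed graph on $N$ nodes; under the graph assumption its eigenvalues are $\lambda_1=0$ (simple) and $\lambda_2,\dots,\lambda_N$ with positive real part. Agents: $\dot{\mathbf x}_i=\mathbf A\mathbf x_i+\mathbf B\mathbf u_i$, $i=1,\dots,N$, $\mathbf A\in\mathbb R^{n\times n}$, $\mathbf B\in\mathbb R^{n\times m}$, $(\mathbf A,\mathbf B)$ stabilizable, $\mathbf K\in\mathbb R^{m\times n}$ with $\mathbf A-\mathbf B\mathbf K$ Hurwitz, control $\mathbf u_i=c\mathbf K\sum_k a_{ik}(\mathbf x_k-\mathbf x_i)$ with scalar coupling gain $c$; $\mathbf x=[\mathbf x_1^T,\dots,\mathbf x_N^T]^T$. The transformed loop transfer functions are $\mathbf G_p(s)=(s\mathbf I_n-\mathbf A)^{-1}\mathbf B\,c\lambda_p\mathbf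 K$, $p=2,\dots,N$. $\bar\sigma$ denotes the largest singular value. A perturbation $\boldsymbol\Delta_p\in\mathbb C^{n\times n}$ in the feedback path of $\mathbf G_p$ is a constant matrix giving the perturbed loop $\mathbf G_p(s)\boldsymbol\Delta_p$, whose closed loop is stable when $\mathbf A-c\lambda_p\mathbf B\mathbf K\boldsymbol\Delta_p$ is Hurwitz. Stability of the multi-agent system (for consensus) means simultaneous stability of the $N-1$ transformed loops $p=2,\dots,N$; "stable independent of unitary phase perturbations" means that it is stable for every choice of unitary $\boldsymbol\Delta_p$ in the feedback paths.
   Formalization: The gain condition is required for all ω_p ≥ 0 rather than ω_p > 0; with ω_p > 0 the "if" part fails, e.g. A = -1, B = K = c = λ_p = 1, where the gain is below 1 for ω > 0 but Δ_p = -1 gives the closed-loop matrix 0. *)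

theory Defs
  imports "HOL-Analysis.Analysis"
begin

section \<open>The weighted directed graph and its Laplacian\<close>

text \<open>The weight \<open>a i k\<close> is used by agent \<open>i\<close> on the state received from agent \<open>k\<close>, so it belongs
  to the directed edge from \<open>k\<close> to \<open>i\<close>. Diagonal weights never enter the Laplacian and carry no
  edge.\<close>

definition edges :: "('v \<Rightarrow> 'v \<Rightarrow> real) \<Rightarrow> ('v \<times> 'v) set" where
  "edges a = {(k, i). k \<noteq> i \<and> 0 < a i k}"

definition strongly_connected :: "('v \<Rightarrow> 'v \<Rightarrow> real) \<Rightarrow> bool" where
  "strongly_connected a \<longleftrightarrow> (\<forall>u v. (u, v) \<in> (edges a)\<^sup>*)"

definition directed_spanning_tree :: "('v \<times> 'v) set \<Rightarrow> ('v \<Rightarrow> 'v \<Rightarrow> real) \<Rightarrow> bool" where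
  "directed_spanning_tree T a \<longleftrightarrow> T \<subseteq> edges a \<and>
     (\<exists>r. (\<forall>u. (u, r) \<notin> T) \<and> (\<forall>v. v \<noteq> r \<longrightarrow> (\<exists>!u. (u, v) \<in> T)) \<and> (\<forall>v. (r, v) \<in> T\<^sup>*))"

definition laplacian :: "('v::finite \<Rightarrow> 'v \<Rightarrow> real) \<Rightarrow> real ^ 'v ^ 'v" where
  "laplacian a = (\<chi> i k. if i = k then (\<Sum>j\<in>UNIV - {i}. a i j) else - a i k)"

section \<open>Complex matrices\<close>

abbreviation cmat :: "real ^ 'n ^ 'm \<Rightarrow> complex ^ 'n ^ 'm" where
  "cmat \<equiv> map_matrix complex_of_real"

definition ctranspose :: "complex ^ 'n ^ 'm \<Rightarrow> complex ^ 'm ^ 'n" where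
  "ctranspose M = map_matrix cnj (transpose M)"

definition unitary :: "complex ^ 'n ^ 'n \<Rightarrow> bool" where
  "unitary U \<longleftrightarrow> ctranspose U ** U = mat 1 \<and> U ** ctranspose U = mat 1"

definition eigenvalue :: "complex ^ 'n ^ 'n \<Rightarrow> complex \<Rightarrow> bool" where
  "eigenvalue M z \<longleftrightarrow> (\<exists>v. v \<noteq> 0 \<and> M *v v = z *s v)"

definition hurwitz :: "complex ^ 'n ^ 'n \<Rightarrow> bool" where
  "hurwitz M \<longleftrightarrow> (\<forall>z. eigenvalue M z \<longrightarrow> Re z < 0)"

definition singular_values :: "complex ^ 'n ^ 'm \<Rightarrow> real set" where
  "singular_values M = {\<sigma>. 0 \<le> \<sigma> \<and> eigenvalue (ctranspose M ** M) (complex_of_real (\<sigma>\<^sup>2))}"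

definition largest_singular_value :: "complex ^ 'n ^ 'm \<Rightarrow> real" where
  "largest_singular_value M = Max (singular_values M)"

text \<open>\<open>l 1, \<dots>, l N\<close> lists the eigenvalues of a real \<open>N \<times> N\<close> matrix with algebraic multiplicity.\<close>

definition eigenvalue_list :: "real ^ 'v ^ 'v \<Rightarrow> (nat \<Rightarrow> complex) \<Rightarrow> bool" where
  "eigenvalue_list L l \<longleftrightarrow>
     (\<forall>z. det (mat z - cmat L) = (\<Prod>p = 1..CARD('v). z - l p))"

section \<open>Agents and transformed loops\<close>

definition stabilizable :: "real ^ 'n ^ 'n \<Rightarrow> real ^ 'm ^ 'n \<Rightarrow> bool" where
  "stabilizable A B \<longleftrightarrow> (\<exists>F :: real ^ 'n ^ 'm. hurwitz (cmat (A - B ** F)))"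

text \<open>\<open>mat z ** M\<close> is the scalar multiple \<open>z M\<close>.\<close>

definition loop_tf ::
  "real ^ 'n ^ 'n \<Rightarrow> real ^ 'm ^ 'n \<Rightarrow> real ^ 'n ^ 'm \<Rightarrow> real \<Rightarrow> complex \<Rightarrow> complex \<Rightarrow> complex ^ 'n ^ 'n"
  where
  "loop_tf A B K c l s =
     matrix_inv (mat s - cmat A) ** cmat B ** (mat (complex_of_real c * l) ** cmat K)"

definition closed_loop ::
  "real ^ 'n ^ 'n \<Rightarrow> real ^ 'm ^ 'n \<Rightarrow> real ^ 'n ^ 'm \<Rightarrow> real \<Rightarrow> complex \<Rightarrow> complex ^ 'n ^ 'n \<Rightarrow>
     complex ^ 'n ^ 'n"
  where
  "closed_loop A B K c l D =
     cmat A - mat (complex_of_real c * l) ** cmat B ** cmat K ** D"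

text \<open>The system \<open>x' = (I \<otimes> A) x - c (L \<otimes> B K) x\<close> decouples, after triangularizing \<open>L\<close>, into loops
  with matrices \<open>A - c l\<^sub>p B K\<close>; the one for \<open>l\<^sub>1 = 0\<close> describes the consensus motion and is not part
  of the stability requirement. The perturbation \<open>D p\<close> acts in the feedback path of loop \<open>p\<close>.\<close>

definition mas_stable ::
  "real ^ 'n ^ 'n \<Rightarrow> real ^ 'm ^ 'n \<Rightarrow> real ^ 'n ^ 'm \<Rightarrow> real \<Rightarrow> nat \<Rightarrow> (nat \<Rightarrow> complex) \<Rightarrow>
     (nat \<Rightarrow> complex ^ 'n ^ 'n) \<Rightarrow> bool"
  where
  "mas_stable A B K c N l D \<longleftrightarrow> (\<forall>p\<in>{2..N}. hurwitz (closed_loop A B K c (l p) (D p)))"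

definition stable_under_unitary_phase ::
  "real ^ 'n ^ 'n \<Rightarrow> real ^ 'm ^ 'n \<Rightarrow> real ^ 'n ^ 'm \<Rightarrow> real \<Rightarrow> nat \<Rightarrow> (nat \<Rightarrow> complex) \<Rightarrow> bool"
  where
  "stable_under_unitary_phase A B K c N l \<longleftrightarrow>
     (\<forall>D. (\<forall>p\<in>{2..N}. unitary (D p)) \<longrightarrow> mas_stable A B K c N l D)"

text \<open>Conditions on the gain of \<open>loop_tf\<close> over frequencies must include zero frequency. Over \<open>\<omega> > 0\<close> alone the largest
  singular value may tend to 1 as \<open>\<omega> \<rightarrow> 0\<close>, and then some unitary perturbation places a closed-loop
  eigenvalue at 0: for \<open>A = -1\<close>, \<open>B = K = c = 1\<close>, \<open>l\<^sub>p = 1\<close> the gain is \<open>1 / \<bar>1 + \<i> \<omega>\<bar>\<close>, which is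
  below 1 for every \<open>\<omega> > 0\<close>, yet the perturbation \<open>-1\<close> gives the closed loop \<open>-1 + 1 = 0\<close>.

  No convention is needed for \<open>matrix_inv\<close> where \<open>\<i> \<omega>\<close> is an eigenvalue of \<open>A\<close>: if
  \<open>A - c l B K\<close> is Hurwitz, the loop gain is unbounded near such a frequency, so the condition
  already fails at neighbouring frequencies.\<close>

end

theory Submission
  imports Defs "HOL-Complex_Analysis.Conformal_Mappings"
begin

text \<open>The loops do not interact, so everything concerns one matrix \<open>M = c l\<^sub>p B K\<close> with \<open>H = A - M\<close>
  Hurwitz. A closed-loop eigenvalue \<open>s\<close> under the perturbation \<open>D\<close> is a solution \<open>z \<noteq> 0\<close>, \<open>u = D z\<close> of
  \<open>s z = A z - M u\<close>. In terms of the difference \<open>d = z - u\<close> this equation reads \<open>z = T(s) d\<close> with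
  \<open>T(s) = (s - H)\<inverse> M\<close>, which, whatever the poles of \<open>(s - A)\<inverse> M\<close>, has none in the closed right
  half-plane. With
  the real inner product of \<open>complex ^ 'n\<close>, comparing the norms of \<open>u = z - d\<close> and \<open>z\<close> becomes comparing
  \<open>|d|\<^sup>2\<close> with \<open>2 T(s) d \<bullet> d\<close>. For fixed \<open>d\<close> the latter is the real part of a holomorphic function of \<open>s\<close>
  that tends to 0 at infinity, and a gain below 1 at \<open>s = \<i> \<omega>\<close> means that it is smaller than \<open>|d|\<^sup>2\<close> for
  every \<open>d \<noteq> 0\<close>.

  If the gain is below 1 on the whole imaginary axis, the maximum principle extends the inequality to
  the closed right half-plane, where \<open>|u| = |z|\<close> is then impossible for \<open>z \<noteq> 0\<close>
  (\<open>hurwitz_unitary_feedback\<close>). Only nonnegative frequencies need to be checked, since \<open>A\<close> and \<open>B K\<close> are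
  real and the phase of \<open>c l\<^sub>p\<close> does not affect norms (\<open>strict_contraction_cnj\<close>).

  If the gain is at least 1 at some frequency, take a \<open>d\<close> violating the inequality there. Along the
  imaginary axis \<open>2 T(\<i> \<omega>) d \<bullet> d\<close> tends to 0, so at some larger frequency it equals \<open>|d|\<^sup>2\<close>. There
  \<open>|u| = |z|\<close>, some unitary matrix maps \<open>z\<close> to \<open>u\<close> (\<open>unitary_transitive\<close>), and it places an eigenvalue on
  the imaginary axis (\<open>destabilizing_unitary_feedback\<close>). Moving to another frequency is essential: where
  all singular values exceed 1, no unitary perturbation creates an eigenvalue at \<open>\<i> \<omega>\<close>.

  At a frequency where \<open>\<i> \<omega>\<close> is an eigenvalue of \<open>A\<close> the transfer function is undefined, but
  \<open>z = d\<close>, \<open>u = 0\<close> violates the inequality, and so by continuity it fails at nearby frequencies as well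
  (\<open>eigenvalue_nearby_gain\<close>).\<close>

section \<open>Complex matrices as operators on a real Euclidean space\<close>

lemma mat_mult_nth: "(mat c ** M) $ i $ j = c * (M :: complex ^ 'n ^ 'm) $ i $ j"
  by (simp add: matrix_matrix_mult_def mat_def if_distrib[of "\<lambda>a. a * _"] cong: if_cong)

lemma mat_mult_vec: "mat c *v x = c *s (x :: complex ^ 'n)"
  by (simp add: vec_eq_iff matrix_vector_mult_def mat_def if_distrib[of "\<lambda>a. a * _"] cong: if_cong)

lemma norm_smult: "norm (c *s x) = cmod c * norm (x :: complex ^ 'n)"
  by (simp add: norm_vec_def norm_mult L2_set_def power_mult_distrib sum_distrib_left[symmetric]
      real_sqrt_mult)

lemma of_real_smult: "complex_of_real r *s x = r *\<^sub>R (x :: complex ^ 'n)"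
  by (simp add: vec_eq_iff scaleR_conv_of_real[where 'a = complex])

lemma inner_cvec: "(x :: complex ^ 'n) \<bullet> y = Re (\<Sum>i\<in>UNIV. x $ i * cnj (y $ i))"
  by (simp add: inner_vec_def inner_complex_def)

lemma ctranspose_inner:
  fixes M :: "complex ^ 'n ^ 'm"
  shows "(ctranspose M *v x) \<bullet> y = x \<bullet> (M *v y)"
proof -
  have "x \<bullet> (M *v y) = Re (\<Sum>i\<in>UNIV. \<Sum>j\<in>UNIV. x $ i * cnj (M $ i $ j) * cnj (y $ j))"
    by (simp add: inner_cvec matrix_vector_mult_def sum_distrib_left mult.assoc
        del: times_complex.sel Re_sum)
  also have "\<dots> = Re (\<Sum>j\<in>UNIV. \<Sum>i\<in>UNIV. x $ i * cnj (M $ i $ j) * cnj (y $ j))"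
    by (subst sum.swap) simp
  also have "\<dots> = (ctranspose M *v x) \<bullet> y"
    by (simp add: inner_cvec matrix_vector_mult_def sum_distrib_left ctranspose_def
        transpose_def mult.commute mult.left_commute del: times_complex.sel Re_sum)
  finally show ?thesis by simp
qed

lemma norm_mult_vec_ctranspose:
  fixes M :: "complex ^ 'n ^ 'm"
  shows "(norm (M *v x))\<^sup>2 = (ctranspose M ** M *v x) \<bullet> x"
  by (simp add: power2_norm_eq_inner matrix_vector_mul_assoc[symmetric] ctranspose_inner)

lemma unitary_norm:
  assumes "unitary U"
  shows "norm (U *v x) = norm x"
proof -
  have "(norm (U *v x))\<^sup>2 = (norm x)\<^sup>2"
    using assms unfolding norm_mult_vec_ctranspose
    by (simp add: unitary_def power2_norm_eq_inner)
  thus ?thesis by simp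
qed

lemma norm_diff_le_iff:
  fixes z d :: "'a::real_inner"
  shows "norm (z - d) \<le> norm z \<longleftrightarrow> (norm d)\<^sup>2 \<le> 2 * (z \<bullet> d)"
  unfolding norm_le by (simp add: inner_diff power2_norm_eq_inner inner_commute)

lemma norm_diff_eq_iff:
  fixes z d :: "'a::real_inner"
  shows "norm (z - d) = norm z \<longleftrightarrow> (norm d)\<^sup>2 = 2 * (z \<bullet> d)"
  unfolding norm_eq by (auto simp: inner_diff power2_norm_eq_inner inner_commute)

text \<open>Since \<open>|z - d| = |z|\<close> says that \<open>2 Re (d\<^sup>* z) = d\<^sup>* d\<close>, the generalized reflection
  \<open>1 - d d\<^sup>* / (d\<^sup>* z)\<close> with \<open>d = z - u\<close> is unitary; it visibly maps \<open>z\<close> to \<open>z - d = u\<close>. The complex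
  denominator absorbs the phase that an ordinary Householder reflection could not correct.\<close>

lemma unitary_transitive:
  fixes z u :: "complex ^ 'n"
  assumes eq: "norm z = norm u" and ne: "z \<noteq> u"
  obtains D where "unitary D" "D *v z = u"
proof -
  define d where "d = z - u"
  define a where "a = (\<Sum>i\<in>UNIV. cnj (d $ i) * z $ i)"
  define q where "q = (\<Sum>i\<in>UNIV. cnj (d $ i) * d $ i)"
  have "(norm d)\<^sup>2 = 2 * (z \<bullet> d)"
    using eq by (simp add: norm_diff_eq_iff[symmetric] d_def)
  moreover have "z \<bullet> d = Re a"
    by (simp add: inner_cvec a_def mult.commute del: times_complex.sel Re_sum)
  moreover have "q = complex_of_real ((norm d)\<^sup>2)"
  proof -
    have "complex_of_real ((norm d)\<^sup>2) = (\<Sum>i\<in>UNIV. complex_of_real ((norm (d $ i))\<^sup>2))"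
      unfolding power2_norm_eq_inner by (simp add: inner_vec_def)
    also have "\<dots> = q"
      unfolding q_def complex_norm_square by (simp add: mult.commute)
    finally show ?thesis by simp
  qed
  ultimately have q: "q = a + cnj a" and "Re a \<noteq> 0"
    using ne by (auto simp: complex_add_cnj d_def)
  hence a: "a \<noteq> 0" by auto
  define D :: "complex ^ 'n ^ 'n"
    where "D = (\<chi> i j. (if i = j then 1 else 0) - d $ i * cnj (d $ j) / a)"
  have "(ctranspose D ** D) $ i $ k = mat 1 $ i $ k" for i k
  proof -
    have "(ctranspose D ** D) $ i $ k =
        (\<Sum>j\<in>UNIV. ((if j = i then 1 else 0) - cnj (d $ j) * d $ i / cnj a) *
          ((if j = k then 1 else 0) - d $ j * cnj (d $ k) / a))"
      by (simp add: matrix_matrix_mult_def ctranspose_def transpose_def D_def if_distrib[of cnj]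
          cong: if_cong)
    also have "\<dots> = (\<Sum>j\<in>UNIV. (if j = i then (if i = k then 1 else 0) else 0)
        - (if j = i then d $ i * cnj (d $ k) / a else 0)
        - (if j = k then cnj (d $ k) * d $ i / cnj a else 0)
        + (cnj (d $ j) * d $ j) * (d $ i * cnj (d $ k) / (a * cnj a)))"
      by (intro sum.cong refl) (auto simp: algebra_simps)
    also have "\<dots> = (if i = k then 1 else 0) - d $ i * cnj (d $ k) / a
        - cnj (d $ k) * d $ i / cnj a + q * (d $ i * cnj (d $ k) / (a * cnj a))"
      by (simp add: sum.distrib sum_subtractf q_def sum_distrib_right sum_divide_distrib)
    also have "\<dots> = (if i = k then 1 else 0)"
      using a by (simp add: q field_simps)
    finally show ?thesis by (simp add: mat_def)
  qed
  hence "ctranspose D ** D = mat 1"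
    by (simp add: vec_eq_iff)
  hence "unitary D"
    using matrix_left_right_inverse unitary_def by blast
  moreover have "D *v z = u"
  proof -
    have "(D *v z) $ i = u $ i" for i
    proof -
      have "(D *v z) $ i =
          (\<Sum>j\<in>UNIV. (if j = i then z $ j else 0) - (d $ i / a) * (cnj (d $ j) * z $ j))"
        unfolding matrix_vector_mult_def
        by (simp add: D_def, intro sum.cong refl) (auto simp: algebra_simps)
      also have "\<dots> = z $ i - (d $ i / a) * a"
        unfolding sum_subtractf sum_distrib_left[symmetric] a_def[symmetric] by simp
      finally show ?thesis using a by (simp add: d_def)
    qed
    thus ?thesis by (simp add: vec_eq_iff)
  qed
  ultimately show ?thesis using that by blast
qed

section \<open>Eigenvalues and the largest singular value\<close>

lemma eigenvalue_iff_det: "eigenvalue H s \<longleftrightarrow> det (mat s - H) = 0"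
proof -
  have "eigenvalue H s \<longleftrightarrow> (\<exists>v. v \<noteq> 0 \<and> (mat s - H) *v v = 0)"
    by (auto simp: eigenvalue_def matrix_vector_mult_diff_rdistrib mat_mult_vec)
  thus ?thesis
    by (metis invertible_det_nz invertible_left_inverse matrix_left_invertible_ker)
qed

lemma eigenvalue_norm_bound:
  fixes H :: "complex ^ 'n ^ 'n"
  shows "\<exists>C. \<forall>x. norm (H *v x) \<le> C * norm x" "\<exists>C. \<forall>s. eigenvalue H s \<longrightarrow> cmod s \<le> C"
proof -
  obtain C where C: "\<And>x. norm (H *v x) \<le> C * norm x"
    using linear_bounded_pos[OF matrix_vector_mul_linear] by blast
  thus "\<exists>C. \<forall>x. norm (H *v x) \<le> C * norm x" by blast
  have "cmod s \<le> C" if ev: "eigenvalue H s" for s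
  proof -
    obtain v where v: "v \<noteq> 0" "H *v v = s *s v"
      using ev unfolding eigenvalue_def by blast
    with C[of v] show ?thesis by (simp add: norm_smult)
  qed
  thus "\<exists>C. \<forall>s. eigenvalue H s \<longrightarrow> cmod s \<le> C" by blast
qed

text \<open>The characteristic polynomial is the determinant of a matrix of polynomials; it is nonzero because
  it does not vanish beyond the norm of \<open>H\<close>.\<close>

lemma finite_eigenvalues: "finite {s. eigenvalue (H :: complex ^ 'n ^ 'n) s}"
proof -
  define P :: "complex poly ^ 'n ^ 'n"
    where "P = (\<chi> i j. if i = j then [:- H $ i $ j, 1:] else [:- H $ i $ j:])"
  have entry: "poly (P $ i $ j) z = (mat z - H) $ i $ j" for i j z
    by (simp add: P_def mat_def)
  have det_P: "poly (det P) z = det (mat z - H)" for z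
    by (simp add: det_def poly_sum poly_prod entry of_int_poly)
  obtain C where C: "\<And>s. eigenvalue H s \<Longrightarrow> cmod s \<le> C"
    using eigenvalue_norm_bound(2)[of H] by blast
  have "\<not> eigenvalue H (complex_of_real (\<bar>C\<bar> + 1))"
  proof
    assume "eigenvalue H (complex_of_real (\<bar>C\<bar> + 1))"
    hence "\<bar>C\<bar> + 1 \<le> C" using C by fastforce
    thus False by simp
  qed
  hence "det P \<noteq> 0"
    by (metis det_P eigenvalue_iff_det poly_0)
  hence "finite {z. poly (det P) z = 0}"
    by (rule poly_roots_finite)
  thus ?thesis by (simp add: det_P eigenvalue_iff_det)
qed

text \<open>The Rayleigh quotient: a maximizer of \<open>|G x|\<close> over the unit sphere is an eigenvector of \<open>G\<^sup>* G\<close>.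
  Besides the bound on the gain it yields the existence of a singular value.\<close>

lemma maximal_gain_eigenvector:
  fixes G :: "complex ^ 'n ^ 'm"
  obtains x m where "x \<noteq> 0" "ctranspose G ** G *v x = complex_of_real m *s x"
    "\<And>y. (norm (G *v y))\<^sup>2 \<le> m * (norm y)\<^sup>2"
proof -
  have lin: "linear (\<lambda>x. G *v x)" by simp
  have "continuous_on (sphere 0 1) (\<lambda>x. (norm (G *v x))\<^sup>2)"
    by (intro continuous_intros linear_continuous_on lin[unfolded linear_conv_bounded_linear])
  moreover have "sphere (0 :: complex ^ 'n) 1 \<noteq> {}"
    by simp
  ultimately obtain x where x: "norm x = 1"
      and sup: "\<And>y. norm y = 1 \<Longrightarrow> (norm (G *v y))\<^sup>2 \<le> (norm (G *v x))\<^sup>2"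
    using continuous_attains_sup[OF compact_sphere, of 0 1 "\<lambda>x. (norm (G *v x))\<^sup>2"] by auto
  define m where "m = (norm (G *v x))\<^sup>2"
  have bound: "(norm (G *v y))\<^sup>2 \<le> m * (norm y)\<^sup>2" for y
  proof (cases "y = 0")
    case False
    have "(norm (G *v (y /\<^sub>R norm y)))\<^sup>2 \<le> m"
      unfolding m_def using False by (intro sup) simp
    thus ?thesis
      using False by (simp add: linear_cmul[OF lin] power_mult_distrib field_simps)
  qed simp
  define e where "e = m *\<^sub>R x - ctranspose G ** G *v x"
  have e: "e \<bullet> e = m * (x \<bullet> e) - (G *v x) \<bullet> (G *v e)"
    by (simp add: e_def inner_diff_left matrix_vector_mul_assoc[symmetric] ctranspose_inner)
  define k where "k = m * (e \<bullet> e) - (G *v e) \<bullet> (G *v e)"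
  have "k \<ge> 0"
    using bound[of e] by (simp add: k_def power2_norm_eq_inner)
  \<comment> \<open>\<open>m |y|\<^sup>2 - |G y|\<^sup>2\<close> vanishes at its minimizer \<open>x\<close>, so it has no descent direction there.\<close>
  have parabola: "0 \<le> 2 * t * (e \<bullet> e) + t\<^sup>2 * k" for t
  proof -
    have expand: "(norm (p + t *\<^sub>R q))\<^sup>2 = (norm p)\<^sup>2 + 2 * t * (p \<bullet> q) + t\<^sup>2 * (q \<bullet> q)"
      for p q :: "complex ^ 'k"
      unfolding power2_norm_eq_inner
      by (simp add: inner_add inner_commute[of q p] power2_eq_square distrib_left)
    have "(norm (G *v x + t *\<^sub>R (G *v e)))\<^sup>2 \<le> m * (norm (x + t *\<^sub>R e))\<^sup>2"
      using bound[of "x + t *\<^sub>R e"] by (simp add: linear_add[OF lin] linear_cmul[OF lin])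
    hence "0 \<le> 2 * t * (m * (x \<bullet> e) - (G *v x) \<bullet> (G *v e)) + t\<^sup>2 * k"
      unfolding expand by (simp add: k_def x m_def[symmetric] algebra_simps)
    thus ?thesis using e by simp
  qed
  have "e \<bullet> e \<le> 0"
  proof -
    \<comment> \<open>The parabola is negative at \<open>t = - (e \<bullet> e) / (k + 1)\<close> unless \<open>e = 0\<close>.\<close>
    define r where "r = 1 / (k + 1)"
    have r: "0 < r" "r * k = 1 - r"
      using \<open>k \<ge> 0\<close> by (simp_all add: r_def field_simps)
    have "0 \<le> 2 * (- r * (e \<bullet> e)) * (e \<bullet> e) + (- r * (e \<bullet> e))\<^sup>2 * k"
      by (rule parabola)
    also have "\<dots> = r * (e \<bullet> e)\<^sup>2 * (r * k - 2)"
      by (simp add: power2_eq_square algebra_simps)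
    also have "\<dots> = - (r * (1 + r) * (e \<bullet> e)\<^sup>2)"
      unfolding r(2) by (simp add: algebra_simps)
    finally have "(e \<bullet> e)\<^sup>2 \<le> 0"
      using r(1) by (simp add: mult_le_0_iff)
    thus ?thesis by simp
  qed
  hence "e = 0" by (meson inner_gt_zero_iff not_less)
  hence "ctranspose G ** G *v x = complex_of_real m *s x"
    by (simp add: e_def of_real_smult)
  moreover have "x \<noteq> 0" using x by auto
  ultimately show ?thesis using that bound by blast
qed

lemma finite_singular_values: "finite (singular_values M)"
proof -
  have "(\<lambda>\<sigma>. complex_of_real (\<sigma>\<^sup>2)) ` singular_values M \<subseteq> {s. eigenvalue (ctranspose M ** M) s}"
    by (auto simp: singular_values_def)
  hence "finite ((\<lambda>\<sigma>. complex_of_real (\<sigma>\<^sup>2)) ` singular_values M)"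
    using finite_eigenvalues finite_subset by blast
  moreover have "inj_on (\<lambda>\<sigma>. complex_of_real (\<sigma>\<^sup>2)) (singular_values M)"
    by (rule inj_onI) (auto simp: singular_values_def power2_eq_iff_nonneg simp flip: of_real_power)
  ultimately show ?thesis using finite_imageD by blast
qed

lemma largest_singular_value_less_1_iff:
  fixes G :: "complex ^ 'n ^ 'm"
  shows "largest_singular_value G < 1 \<longleftrightarrow> (\<forall>y. y \<noteq> 0 \<longrightarrow> norm (G *v y) < norm y)"
proof -
  obtain x m where x: "x \<noteq> 0" "ctranspose G ** G *v x = complex_of_real m *s x"
    and bound: "\<And>y. (norm (G *v y))\<^sup>2 \<le> m * (norm y)\<^sup>2"
    using maximal_gain_eigenvector[of G] by blast
  have "0 \<le> m * (norm x)\<^sup>2"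
    using bound[of x] by (meson order_trans zero_le_power2)
  hence m: "0 \<le> m"
    using x(1) by (simp add: zero_le_mult_iff)
  hence sqrt_m: "sqrt m \<in> singular_values G"
    using x unfolding singular_values_def eigenvalue_def
    by (metis (mono_tags, lifting) mem_Collect_eq real_sqrt_ge_zero real_sqrt_pow2)
  show ?thesis
  proof
    assume "largest_singular_value G < 1"
    hence "sqrt m < 1"
      using sqrt_m finite_singular_values[of G] Max_ge unfolding largest_singular_value_def
      by (meson le_less_trans)
    hence "m < 1" by simp
    show "\<forall>y. y \<noteq> 0 \<longrightarrow> norm (G *v y) < norm y"
    proof (intro allI impI)
      fix y :: "complex ^ 'n" assume "y \<noteq> 0"
      hence "m * (norm y)\<^sup>2 < (norm y)\<^sup>2" using \<open>m < 1\<close> by simp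
      hence "(norm (G *v y))\<^sup>2 < (norm y)\<^sup>2" using bound[of y] by linarith
      thus "norm (G *v y) < norm y" by (rule power_less_imp_less_base) simp
    qed
  next
    assume contr: "\<forall>y. y \<noteq> 0 \<longrightarrow> norm (G *v y) < norm y"
    have "\<sigma> < 1" if "\<sigma> \<in> singular_values G" for \<sigma>
    proof -
      from that obtain v where v: "v \<noteq> 0" "ctranspose G ** G *v v = complex_of_real (\<sigma>\<^sup>2) *s v"
        by (auto simp: singular_values_def eigenvalue_def)
      have "\<sigma>\<^sup>2 * (norm v)\<^sup>2 = (norm (G *v v))\<^sup>2"
        unfolding norm_mult_vec_ctranspose v(2) of_real_smult by (simp add: power2_norm_eq_inner)
      also have "\<dots> < (norm v)\<^sup>2"
        using contr v(1) by (intro power_strict_mono) auto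
      finally have "\<sigma>\<^sup>2 < 1\<^sup>2" using v(1) by simp
      thus ?thesis using power_less_imp_less_base by fastforce
    qed
    thus "largest_singular_value G < 1"
      unfolding largest_singular_value_def
      using sqrt_m finite_singular_values[of G] by (subst Max_less_iff) auto
  qed
qed

section \<open>The resolvent\<close>

lemma resolvent_eq_iff:
  assumes "\<not> eigenvalue H s"
  shows "(mat s - H) *v x = b \<longleftrightarrow> x = matrix_inv (mat s - H) *v b"
proof -
  have "invertible (mat s - H)"
    using assms by (simp add: eigenvalue_iff_det invertible_det_nz)
  hence inv: "(mat s - H) ** matrix_inv (mat s - H) = mat 1 \<and>
      matrix_inv (mat s - H) ** (mat s - H) = mat 1"
    unfolding invertible_def matrix_inv_def by (rule someI_ex)
  show ?thesis
  proof
    assume "(mat s - H) *v x = b"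
    thus "x = matrix_inv (mat s - H) *v b"
      using inv by (auto simp: matrix_vector_mul_assoc)
  next
    assume "x = matrix_inv (mat s - H) *v b"
    thus "(mat s - H) *v x = b"
      using inv by (simp add: matrix_vector_mul_assoc)
  qed
qed

lemma holomorphic_on_det:
  assumes "\<And>i j. (\<lambda>s. F s $ i $ j) holomorphic_on S"
  shows "(\<lambda>s. det (F s)) holomorphic_on S"
  unfolding det_def by (intro holomorphic_intros assms)

text \<open>By Cramer's rule the components are quotients of determinants with entries affine in \<open>s\<close>.\<close>

lemma holomorphic_on_resolvent:
  "(\<lambda>s. (matrix_inv (mat s - H) *v b) $ k) holomorphic_on {s. \<not> eigenvalue H s}"
proof -
  define N where "N = (\<lambda>s. \<chi> i j. if j = k then b $ i else (mat s - H) $ i $ j)"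
  have entry: "(\<lambda>s. (mat s - H) $ i $ j) holomorphic_on S" for i j S
    by (cases "i = j") (auto simp: mat_def intro!: holomorphic_intros)
  have "(\<lambda>s. N s $ i $ j) holomorphic_on S" for i j S
  proof -
    have "(\<lambda>s. N s $ i $ j) = (if j = k then (\<lambda>_. b $ i) else (\<lambda>s. (mat s - H) $ i $ j))"
      by (auto simp: N_def)
    thus ?thesis using entry by simp
  qed
  hence "(\<lambda>s. det (N s) / det (mat s - H)) holomorphic_on {s. \<not> eigenvalue H s}"
    by (intro holomorphic_on_divide holomorphic_on_det entry) (auto simp: eigenvalue_iff_det)
  moreover have "(matrix_inv (mat s - H) *v b) $ k = det (N s) / det (mat s - H)"
    if s: "s \<in> {s. \<not> eigenvalue H s}" for s
  proof -
    have "(mat s - H) *v (matrix_inv (mat s - H) *v b) = b"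
      using resolvent_eq_iff[of H s] s by blast
    moreover have "det (mat s - H) \<noteq> 0"
      using s by (simp add: eigenvalue_iff_det)
    ultimately have "matrix_inv (mat s - H) *v b =
        (\<chi> k. det (\<chi> i j. if j = k then b $ i else (mat s - H) $ i $ j) / det (mat s - H))"
      using cramer by blast
    thus ?thesis by (simp add: N_def)
  qed
  ultimately show ?thesis
    using holomorphic_cong by (smt (verit))
qed

lemma resolvent_tendsto_0:
  fixes H :: "complex ^ 'n ^ 'n"
  shows "((\<lambda>s. matrix_inv (mat s - H) *v b) \<longlongrightarrow> 0) at_infinity"
proof -
  obtain C where C: "\<And>x. norm (H *v x) \<le> C * norm x"
    using eigenvalue_norm_bound(1)[of H] by blast
  obtain C' where C': "\<And>s. eigenvalue H s \<Longrightarrow> cmod s \<le> C'"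
    using eigenvalue_norm_bound(2)[of H] by blast
  have bound: "norm (matrix_inv (mat s - H) *v b) \<le> norm b / (cmod s - C)"
    if s: "cmod s > \<bar>C\<bar> + \<bar>C'\<bar>" for s
  proof -
    define x where "x = matrix_inv (mat s - H) *v b"
    have "\<not> eigenvalue H s" using C'[of s] s by linarith
    hence "(mat s - H) *v x = b" using resolvent_eq_iff x_def by blast
    hence "s *s x = b + H *v x"
      by (simp add: matrix_vector_mult_diff_rdistrib mat_mult_vec algebra_simps)
    hence "cmod s * norm x \<le> norm b + C * norm x"
      using norm_triangle_ineq[of b "H *v x"] C[of x] by (simp add: norm_smult[symmetric])
    thus ?thesis
      using s unfolding x_def[symmetric] by (simp add: field_simps)
  qed
  have "filterlim (\<lambda>s::complex. - C + cmod s) at_top at_infinity"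
    by (rule filterlim_tendsto_add_at_top[OF tendsto_const filterlim_norm_at_top])
  hence "((\<lambda>s. norm b / (- C + cmod s)) \<longlongrightarrow> 0) at_infinity"
    by (intro tendsto_divide_0[OF tendsto_const] filterlim_at_top_imp_at_infinity)
  moreover have "\<forall>\<^sub>F s in at_infinity.
      norm (matrix_inv (mat s - H) *v b) \<le> norm b / (- C + cmod s)"
    using filterlim_at_top_dense[THEN iffD1, OF filterlim_norm_at_top, rule_format,
        of "\<bar>C\<bar> + \<bar>C'\<bar>"]
    by eventually_elim (use bound in force)
  ultimately show ?thesis
    by (rule Lim_null_comparison[rotated])
qed

text \<open>The decay at infinity reduces the claim to the maximum principle on a large half-disc. The strict
  bound survives because the real part attains its maximum over the compact boundary of the half-disc.\<close>

lemma right_half_plane_maximum: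
  assumes holo: "f holomorphic_on {s. 0 \<le> Re s}"
    and lim: "(f \<longlongrightarrow> 0) at_infinity"
    and axis: "\<And>\<omega>. Re (f (\<i> * complex_of_real \<omega>)) < b" and "0 < b"
    and s: "0 \<le> Re s"
  shows "Re (f s) < b"
proof -
  have "\<forall>\<^sub>F z in at_infinity. dist (f z) 0 < b"
    using lim \<open>0 < b\<close> by (rule tendstoD)
  then obtain R where R: "\<And>z. R \<le> cmod z \<Longrightarrow> cmod (f z) < b"
    by (auto simp: eventually_at_infinity)
  define r where "r = max R (cmod s)"
  define P where "P = {z. (1 :: complex) \<bullet> z \<ge> 0}"
  have P: "P = {z. 0 \<le> Re z}" by (simp add: P_def inner_complex_def)
  define S where "S = cball 0 r \<inter> P"
  have "closed P" unfolding P_def by (rule closed_halfspace_ge)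
  hence "compact S" unfolding S_def by (intro compact_Int_closed compact_cball)
  hence "closed S" "bounded S" by (auto simp: compact_imp_closed compact_imp_bounded)
  have "s \<in> S" using s by (simp add: S_def P r_def)
  have holo_S: "f holomorphic_on S"
    using holo by (rule holomorphic_on_subset) (auto simp: S_def P)
  have frontier: "Re (f z) < b" if "z \<in> frontier S" for z
  proof -
    have "z \<in> frontier (cball 0 r) \<union> frontier P"
      using that frontier_Int_subset[of "cball 0 r" P] by (auto simp only: S_def)
    moreover have "frontier P = {z. (1 :: complex) \<bullet> z = 0}"
      unfolding P_def by (rule frontier_halfspace_ge) simp
    hence "frontier P = {z. Re z = 0}" by (simp add: inner_complex_def)
    ultimately have "cmod z = r \<or> Re z = 0"
      unfolding frontier_cball by simp
    then consider "cmod z = r" | "Re z = 0" by blast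
    thus ?thesis
    proof cases
      case 1
      hence "cmod (f z) < b" by (intro R) (simp add: r_def)
      thus ?thesis using complex_Re_le_cmod[of "f z"] by linarith
    next
      case 2
      hence "z = \<i> * complex_of_real (Im z)" by (simp add: complex_eq_iff)
      thus ?thesis using axis[of "Im z"] by metis
    qed
  qed
  have "frontier S \<noteq> {}"
    using \<open>s \<in> S\<close> \<open>bounded S\<close> not_bounded_UNIV unfolding frontier_eq_empty by blast
  moreover have "compact (frontier S)"
    using \<open>compact S\<close> by (rule compact_frontier)
  moreover have "continuous_on (frontier S) (\<lambda>z. Re (f z))"
    by (intro continuous_on_Re continuous_on_subset[OF holomorphic_on_imp_continuous_on[OF holo_S]]
        frontier_subset_closed \<open>closed S\<close>)
  ultimately obtain w where w: "w \<in> frontier S" "\<And>z. z \<in> frontier S \<Longrightarrow> Re (f z) \<le> Re (f w)"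
    using continuous_attains_sup[of "frontier S" "\<lambda>z. Re (f z)"] by blast
  have "Re (f s) \<le> Re (f w)"
  proof (rule maximum_real_frontier[where f = f and S = S])
    show "f holomorphic_on interior S"
      using holo_S interior_subset by (rule holomorphic_on_subset)
    show "continuous_on (closure S) f"
      using holomorphic_on_imp_continuous_on[OF holo_S] \<open>closed S\<close> by (simp add: closure_closed)
  qed (fact \<open>bounded S\<close> w(2) \<open>s \<in> S\<close>)+
  thus ?thesis using frontier[OF w(1)] by linarith
qed

section \<open>Modes of a loop and unitary feedback\<close>

text \<open>A pair \<open>(z, u)\<close> with \<open>s z = A z - M u\<close> is a mode of the loop cut open at its feedback path. When
  \<open>s - A\<close> is invertible the condition says that \<open>(s - A)\<inverse> M\<close> has norm less than 1; this form of it also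
  makes sense, and fails, at the eigenvalues of \<open>A\<close>.\<close>

definition strict_contraction :: "complex ^ 'n ^ 'n \<Rightarrow> complex ^ 'n ^ 'n \<Rightarrow> complex \<Rightarrow> bool" where
  "strict_contraction A M s \<longleftrightarrow>
     (\<forall>z u. s *s z = A *v z - M *v u \<and> norm u \<le> norm z \<longrightarrow> z = 0)"

text \<open>With \<open>G = (s - A)\<inverse> M\<close> this is \<open>(1 + G)\<inverse> G d\<close>, the complementary sensitivity of control theory.\<close>

definition comp_sensitivity ::
  "complex ^ 'n ^ 'n \<Rightarrow> complex ^ 'n ^ 'n \<Rightarrow> complex ^ 'n \<Rightarrow> complex \<Rightarrow> complex ^ 'n" where
  "comp_sensitivity A M d s = matrix_inv (mat s - (A - M)) *v (M *v d)"

text \<open>Adding \<open>M z\<close> to both sides of \<open>(s - A) z = - M u\<close> replaces the pole set of the open loop by that of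
  the nominal closed loop.\<close>

lemma comp_sensitivity_iff:
  assumes "\<not> eigenvalue (A - M) s"
  shows "s *s z = A *v z - M *v u \<longleftrightarrow> z = comp_sensitivity A M (z - u) s"
proof -
  have "s *s z = A *v z - M *v u \<longleftrightarrow> (mat s - (A - M)) *v z = M *v (z - u)"
    by (auto simp: matrix_vector_mult_diff_rdistrib matrix_vector_mult_diff_distrib mat_mult_vec
        algebra_simps)
  thus ?thesis
    using resolvent_eq_iff[OF assms] by (simp add: comp_sensitivity_def)
qed

lemma strict_contraction_iff:
  assumes "\<not> eigenvalue (A - M) s"
  shows "strict_contraction A M s \<longleftrightarrow>
    (\<forall>d. d \<noteq> 0 \<longrightarrow> 2 * (comp_sensitivity A M d s \<bullet> d) < (norm d)\<^sup>2)"
proof (intro iffI allI impI)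
  fix d :: "complex ^ 'a"
  assume contr: "strict_contraction A M s" and d: "d \<noteq> 0"
  define z where "z = comp_sensitivity A M d s"
  show "2 * (comp_sensitivity A M d s \<bullet> d) < (norm d)\<^sup>2"
  proof (rule ccontr)
    assume "\<not> 2 * (comp_sensitivity A M d s \<bullet> d) < (norm d)\<^sup>2"
    hence "norm (z - d) \<le> norm z" by (simp add: norm_diff_le_iff z_def)
    moreover have "s *s z = A *v z - M *v (z - d)"
      using comp_sensitivity_iff[OF assms, of z "z - d"] by (simp add: z_def)
    ultimately have "z = 0" using contr unfolding strict_contraction_def by blast
    thus False using \<open>norm (z - d) \<le> norm z\<close> d by simp
  qed
next
  assume R: "\<forall>d. d \<noteq> 0 \<longrightarrow> 2 * (comp_sensitivity A M d s \<bullet> d) < (norm d)\<^sup>2"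
  show "strict_contraction A M s"
    unfolding strict_contraction_def
  proof (intro allI impI, elim conjE)
    fix z u
    assume eq: "s *s z = A *v z - M *v u" and le: "norm u \<le> norm z"
    define d where "d = z - u"
    have z: "z = comp_sensitivity A M d s"
      using eq comp_sensitivity_iff[OF assms] by (simp add: d_def)
    have "norm (z - d) \<le> norm z" using le by (simp add: d_def)
    hence "(norm d)\<^sup>2 \<le> 2 * (z \<bullet> d)" by (simp only: norm_diff_le_iff)
    hence "d = 0" using R z by force
    thus "z = 0" using z by (simp add: comp_sensitivity_def)
  qed
qed

lemma strict_contraction_not_eigenvalue:
  assumes "strict_contraction A M s"
  shows "\<not> eigenvalue A s"
proof
  assume "eigenvalue A s"
  then obtain v where v: "v \<noteq> 0" "A *v v = s *s v" unfolding eigenvalue_def by blast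
  hence "s *s v = A *v v - M *v 0 \<and> norm (0 :: complex ^ 'a) \<le> norm v" by simp
  thus False using assms v(1) unfolding strict_contraction_def by blast
qed

lemma strict_contraction_iff_gain:
  assumes "\<not> eigenvalue A s"
  shows "strict_contraction A M s \<longleftrightarrow> largest_singular_value (matrix_inv (mat s - A) ** M) < 1"
proof -
  define G where "G = matrix_inv (mat s - A) ** M"
  have eq: "s *s z = A *v z - M *v u \<longleftrightarrow> z = G *v (- u)" for z u
  proof -
    have "s *s z = A *v z - M *v u \<longleftrightarrow> (mat s - A) *v z = M *v (- u)"
      by (auto simp: matrix_vector_mult_diff_rdistrib mat_mult_vec linear_neg[OF matrix_vector_mul_linear]
          algebra_simps)
    thus ?thesis
      using resolvent_eq_iff[OF assms, of z "M *v (- u)"] by (simp add: G_def matrix_vector_mul_assoc)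
  qed
  have "strict_contraction A M s \<longleftrightarrow> (\<forall>y. norm y \<le> norm (G *v y) \<longrightarrow> G *v y = 0)"
    unfolding strict_contraction_def eq by (metis minus_minus norm_minus_cancel)
  also have "\<dots> \<longleftrightarrow> (\<forall>y. y \<noteq> 0 \<longrightarrow> norm (G *v y) < norm y)"
    by (metis norm_le_zero_iff norm_zero not_le matrix_vector_mult_0_right order_refl)
  finally show ?thesis
    unfolding largest_singular_value_less_1_iff G_def .
qed

lemma holomorphic_on_comp_sensitivity:
  "(\<lambda>s. \<Sum>k\<in>UNIV. comp_sensitivity A M d s $ k * cnj (d $ k)) holomorphic_on {s. \<not> eigenvalue (A - M) s}"
  unfolding comp_sensitivity_def by (intro holomorphic_intros holomorphic_on_resolvent)

lemma Re_comp_sensitivity: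
  "Re (\<Sum>k\<in>UNIV. comp_sensitivity A M d s $ k * cnj (d $ k)) = comp_sensitivity A M d s \<bullet> d"
  by (rule inner_cvec[symmetric])

lemma comp_sensitivity_tendsto_0:
  "((\<lambda>s. \<Sum>k\<in>UNIV. comp_sensitivity A M d s $ k * cnj (d $ k)) \<longlongrightarrow> 0) at_infinity"
proof -
  have comp: "((\<lambda>s. comp_sensitivity A M d s $ k) \<longlongrightarrow> 0 $ k) at_infinity" for k
    unfolding comp_sensitivity_def by (intro tendsto_vec_nth resolvent_tendsto_0)
  hence "((\<lambda>s. \<Sum>k\<in>UNIV. comp_sensitivity A M d s $ k * cnj (d $ k)) \<longlongrightarrow>
      (\<Sum>k\<in>UNIV. 0 $ k * cnj (d $ k))) at_infinity"
    by (intro tendsto_sum tendsto_mult tendsto_const comp)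
  thus ?thesis by simp
qed

lemma hurwitz_not_eigenvalue: "hurwitz H \<Longrightarrow> 0 \<le> Re s \<Longrightarrow> \<not> eigenvalue H s"
  unfolding hurwitz_def by force

lemma continuous_comp_sensitivity_axis:
  assumes "hurwitz (A - M)"
  shows "continuous_on UNIV (\<lambda>\<omega>. comp_sensitivity A M d (\<i> * complex_of_real \<omega>) \<bullet> d)"
proof -
  have "continuous_on {s. \<not> eigenvalue (A - M) s} (\<lambda>s. comp_sensitivity A M d s \<bullet> d)"
    unfolding Re_comp_sensitivity[symmetric]
    by (intro continuous_on_Re holomorphic_on_imp_continuous_on holomorphic_on_comp_sensitivity)
  moreover have "continuous_on UNIV (\<lambda>\<omega>. \<i> * complex_of_real \<omega>)"
    by (intro continuous_intros)
  ultimately show ?thesis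
    by (rule continuous_on_compose2) (use hurwitz_not_eigenvalue[OF assms] in auto)
qed

text \<open>The maximum principle is applied for each difference \<open>d\<close> separately, to the scalar function
  \<open>s \<mapsto> d\<^sup>* T(s) d\<close>.\<close>

lemma strict_contraction_right_half_plane:
  assumes hurw: "hurwitz (A - M)"
    and axis: "\<And>\<omega>. strict_contraction A M (\<i> * complex_of_real \<omega>)"
    and s: "0 \<le> Re s"
  shows "strict_contraction A M s"
proof -
  have "2 * (comp_sensitivity A M d s \<bullet> d) < (norm d)\<^sup>2" if d: "d \<noteq> 0" for d
  proof -
    have "Re (\<Sum>k\<in>UNIV. comp_sensitivity A M d s $ k * cnj (d $ k)) < (norm d)\<^sup>2 / 2"
    proof (rule right_half_plane_maximum[OF _ comp_sensitivity_tendsto_0 _ _ s])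
      show "(\<lambda>s. \<Sum>k\<in>UNIV. comp_sensitivity A M d s $ k * cnj (d $ k)) holomorphic_on {s. 0 \<le> Re s}"
        using holomorphic_on_comp_sensitivity
        by (rule holomorphic_on_subset) (use hurwitz_not_eigenvalue[OF hurw] in auto)
      show "Re (\<Sum>k\<in>UNIV. comp_sensitivity A M d (\<i> * complex_of_real \<omega>) $ k * cnj (d $ k))
          < (norm d)\<^sup>2 / 2" for \<omega>
        using axis[of \<omega>] d strict_contraction_iff[of A M "\<i> * complex_of_real \<omega>"]
          hurwitz_not_eigenvalue[OF hurw, of "\<i> * complex_of_real \<omega>"]
        unfolding Re_comp_sensitivity by fastforce
    qed (use d in simp)
    thus ?thesis unfolding Re_comp_sensitivity by simp
  qed
  thus ?thesis
    using strict_contraction_iff[OF hurwitz_not_eigenvalue[OF hurw s]] by blast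
qed

lemma hurwitz_unitary_feedback:
  assumes hurw: "hurwitz (A - M)"
    and axis: "\<And>\<omega>. strict_contraction A M (\<i> * complex_of_real \<omega>)"
    and D: "unitary D"
  shows "hurwitz (A - M ** D)"
  unfolding hurwitz_def
proof (intro allI impI, rule ccontr)
  fix s assume "eigenvalue (A - M ** D) s" and "\<not> Re s < 0"
  then obtain v where v: "v \<noteq> 0" "(A - M ** D) *v v = s *s v" unfolding eigenvalue_def by blast
  have "s *s v = A *v v - M *v (D *v v)"
    using v(2) by (simp add: matrix_vector_mult_diff_rdistrib matrix_vector_mul_assoc)
  moreover have "norm (D *v v) \<le> norm v"
    using unitary_norm[OF D] by simp
  moreover have "strict_contraction A M s"
    using strict_contraction_right_half_plane[OF hurw axis] \<open>\<not> Re s < 0\<close> by simp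
  ultimately have "v = 0" unfolding strict_contraction_def by blast
  thus False using v(1) by simp
qed

text \<open>The same \<open>d\<close> that violates the contraction inequality at \<open>\<omega>\<close> satisfies it at high frequencies, so
  the intermediate value theorem gives a frequency of equal norms, where a unitary matrix can close
  the loop.\<close>

lemma destabilizing_unitary_feedback:
  assumes hurw: "hurwitz (A - M)"
    and fails: "\<not> strict_contraction A M (\<i> * complex_of_real \<omega>)"
  obtains D where "unitary D" "\<not> hurwitz (A - M ** D)"
proof -
  have regular: "\<not> eigenvalue (A - M) (\<i> * complex_of_real t)" for t
    using hurwitz_not_eigenvalue[OF hurw] by simp
  define \<phi> where "\<phi> = (\<lambda>d t. comp_sensitivity A M d (\<i> * complex_of_real t) \<bullet> d)"
  obtain d where d: "d \<noteq> 0" "(norm d)\<^sup>2 / 2 \<le> \<phi> d \<omega>"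
    using fails unfolding strict_contraction_iff[OF regular] \<phi>_def by force
  have "filterlim (\<lambda>t. \<i> * complex_of_real t) at_infinity at_top"
    by (intro filterlim_norm_at_top_imp_at_infinity) (simp add: norm_mult filterlim_abs_real)
  hence "((\<lambda>t. \<Sum>k\<in>UNIV. comp_sensitivity A M d (\<i> * complex_of_real t) $ k * cnj (d $ k)) \<longlongrightarrow> 0) at_top"
    by (rule filterlim_compose[OF comp_sensitivity_tendsto_0])
  hence "(\<phi> d \<longlongrightarrow> 0) at_top"
    unfolding \<phi>_def Re_comp_sensitivity[symmetric] by (auto dest: tendsto_Re)
  hence "\<forall>\<^sub>F t in at_top. \<phi> d t < (norm d)\<^sup>2 / 2"
    by (rule order_tendstoD) (use d in simp)
  moreover have "\<forall>\<^sub>F t in at_top. \<omega> \<le> t"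
    by (rule eventually_ge_at_top)
  ultimately obtain t where "\<phi> d t < (norm d)\<^sup>2 / 2" "\<omega> \<le> t"
    by (metis (mono_tags, lifting) eventually_conj eventually_happens trivial_limit_at_top_linorder)
  moreover have "continuous_on {\<omega>..t} (\<phi> d)"
    unfolding \<phi>_def using continuous_comp_sensitivity_axis[OF hurw] continuous_on_subset by blast
  ultimately obtain \<tau> where \<tau>: "\<phi> d \<tau> = (norm d)\<^sup>2 / 2"
    using IVT2'[of "\<phi> d" t "(norm d)\<^sup>2 / 2" \<omega>] d(2) by auto
  define z where "z = comp_sensitivity A M d (\<i> * complex_of_real \<tau>)"
  have inner: "(norm d)\<^sup>2 = 2 * (z \<bullet> d)"
    using \<tau> by (simp add: \<phi>_def z_def)
  hence z: "z \<noteq> 0" using d(1) by auto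
  have "norm z = norm (z - d)"
    using inner norm_diff_eq_iff by metis
  moreover have "z \<noteq> z - d" using d(1) by simp
  ultimately obtain D where D: "unitary D" "D *v z = z - d"
    by (rule unitary_transitive)
  have "(\<i> * complex_of_real \<tau>) *s z = A *v z - M *v (z - d)"
    using comp_sensitivity_iff[OF regular] by (simp add: z_def)
  hence "eigenvalue (A - M ** D) (\<i> * complex_of_real \<tau>)"
    unfolding eigenvalue_def using z D(2)
    by (intro exI[of _ z]) (simp add: matrix_vector_mult_diff_rdistrib matrix_vector_mul_assoc[symmetric])
  hence "\<not> hurwitz (A - M ** D)"
    using hurwitz_not_eigenvalue by fastforce
  thus ?thesis using that D(1) by blast
qed

text \<open>An eigenvector \<open>v\<close> of \<open>A\<close> is a mode with zero feedback signal, so \<open>T v = v\<close>, which violates the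
  inequality by a margin that continuity preserves. The eigenvalues being finite, almost all
  neighbouring frequencies are regular.\<close>

lemma eigenvalue_nearby_gain:
  assumes hurw: "hurwitz (A - M)"
    and eig: "eigenvalue A (\<i> * complex_of_real \<omega>)"
  obtains t where "\<omega> < t" "\<not> eigenvalue A (\<i> * complex_of_real t)"
    "\<not> strict_contraction A M (\<i> * complex_of_real t)"
proof -
  have regular: "\<not> eigenvalue (A - M) (\<i> * complex_of_real t)" for t
    using hurwitz_not_eigenvalue[OF hurw] by simp
  from eig obtain v where v: "v \<noteq> 0" "A *v v = (\<i> * complex_of_real \<omega>) *s v"
    unfolding eigenvalue_def by blast
  define \<phi> where "\<phi> = (\<lambda>t. comp_sensitivity A M v (\<i> * complex_of_real t) \<bullet> v)"
  have "v = comp_sensitivity A M (v - 0) (\<i> * complex_of_real \<omega>)"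
    using v(2) comp_sensitivity_iff[OF regular, of \<omega> v 0] by simp
  hence "\<phi> \<omega> = (norm v)\<^sup>2"
    by (simp add: \<phi>_def power2_norm_eq_inner)
  moreover have "isCont \<phi> \<omega>"
    using continuous_comp_sensitivity_axis[OF hurw] by (simp add: \<phi>_def continuous_on_eq_continuous_at)
  ultimately have "(\<phi> \<longlongrightarrow> (norm v)\<^sup>2) (at_right \<omega>)"
    by (metis continuous_at_imp_continuous_at_within continuous_within)
  hence "\<forall>\<^sub>F t in at_right \<omega>. (norm v)\<^sup>2 / 2 < \<phi> t"
    by (rule order_tendstoD) (use v(1) in simp)
  moreover have "\<forall>\<^sub>F t in at_right \<omega>. \<not> eigenvalue A (\<i> * complex_of_real t)"
  proof -
    have "finite ((\<lambda>t. \<i> * complex_of_real t) -` {s. eigenvalue A s})"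
      by (intro finite_vimageI finite_eigenvalues) (simp add: inj_def)
    hence "\<not> \<omega> islimpt (\<lambda>t. \<i> * complex_of_real t) -` {s. eigenvalue A s}"
      by (rule islimpt_finite)
    hence "\<forall>\<^sub>F t in at \<omega>. t \<notin> (\<lambda>t. \<i> * complex_of_real t) -` {s. eigenvalue A s}"
      by (simp add: islimpt_iff_eventually)
    thus ?thesis
      by (auto simp: eventually_at_split)
  qed
  moreover have "\<forall>\<^sub>F t in at_right \<omega>. \<omega> < t"
    by (rule eventually_at_right_less)
  ultimately obtain t where t: "(norm v)\<^sup>2 / 2 < \<phi> t" "\<not> eigenvalue A (\<i> * complex_of_real t)" "\<omega> < t"
    by (metis (mono_tags, lifting) eventually_conj eventually_happens trivial_limit_at_right_real)
  have "\<not> strict_contraction A M (\<i> * complex_of_real t)"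
    using t(1) v(1) unfolding strict_contraction_iff[OF regular] \<phi>_def by force
  thus ?thesis using that t by blast
qed

text \<open>Conjugating a mode at \<open>cnj s\<close> turns \<open>\<mu>\<close> into \<open>cnj \<mu>\<close>; the unimodular factor \<open>cnj \<mu> / \<mu>\<close> can be moved
  into \<open>u\<close>, leaving its norm unchanged.\<close>

lemma strict_contraction_cnj:
  fixes A N :: "real ^ 'n ^ 'n"
  assumes contr: "strict_contraction (cmat A) (mat \<mu> ** cmat N) s"
  shows "strict_contraction (cmat A) (mat \<mu> ** cmat N) (cnj s)"
  unfolding strict_contraction_def
proof (intro allI impI, elim conjE)
  fix z u
  assume eq: "cnj s *s z = cmat A *v z - (mat \<mu> ** cmat N) *v u" and le: "norm u \<le> norm z"
  define conj :: "complex ^ 'n \<Rightarrow> complex ^ 'n" where "conj = (\<lambda>x. \<chi> i. cnj (x $ i))"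
  define \<rho> where "\<rho> = (if \<mu> = 0 then 1 else cnj \<mu> / \<mu>)"
  have \<rho>: "\<mu> * \<rho> = cnj \<mu>" "cmod \<rho> = 1"
    by (auto simp: \<rho>_def norm_divide)
  have real: "cmat X *v conj x = conj (cmat X *v x)" for X :: "real ^ 'n ^ 'n" and x
    by (simp add: vec_eq_iff conj_def matrix_vector_mult_def)
  have norm_conj: "norm (conj x) = norm x" for x
    by (simp add: conj_def norm_vec_def)
  have mat_smult: "(mat c ** X) *v x = c *s (X *v x)" for c and X :: "complex ^ 'n ^ 'n" and x
    by (simp add: matrix_vector_mul_assoc[symmetric] mat_mult_vec)
  have "s *s conj z = conj (cnj s *s z)"
    by (simp add: vec_eq_iff conj_def)
  also have "\<dots> = conj (cmat A *v z) - cnj \<mu> *s conj (cmat N *v u)"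
    unfolding eq mat_smult by (simp add: vec_eq_iff conj_def)
  also have "\<dots> = cmat A *v conj z - (mat \<mu> ** cmat N) *v (\<rho> *s conj u)"
    unfolding mat_smult real[symmetric]
    by (simp add: \<rho>(1)[symmetric] vector_scalar_commute)
  finally have "s *s conj z = cmat A *v conj z - (mat \<mu> ** cmat N) *v (\<rho> *s conj u)" .
  moreover have "norm (\<rho> *s conj u) \<le> norm (conj z)"
    using le by (simp add: norm_smult \<rho>(2) norm_conj)
  ultimately have "conj z = 0"
    using contr unfolding strict_contraction_def by blast
  thus "z = 0"
    using norm_conj[of z] by simp
qed

lemma strict_contraction_axis_iff_gain:
  fixes A N :: "real ^ 'n ^ 'n" and \<mu> :: complex
  defines "M \<equiv> mat \<mu> ** cmat N"
  assumes hurw: "hurwitz (cmat A - M)"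
  shows "(\<forall>\<omega>. strict_contraction (cmat A) M (\<i> * complex_of_real \<omega>)) \<longleftrightarrow>
    (\<forall>\<omega>\<ge>0. largest_singular_value (matrix_inv (mat (\<i> * complex_of_real \<omega>) - cmat A) ** M) < 1)"
    (is "_ \<longleftrightarrow> ?gain")
proof
  assume "\<forall>\<omega>. strict_contraction (cmat A) M (\<i> * complex_of_real \<omega>)"
  thus ?gain
    using strict_contraction_iff_gain strict_contraction_not_eigenvalue by blast
next
  assume gain: ?gain
  have pos: "strict_contraction (cmat A) M (\<i> * complex_of_real \<omega>)" if "0 \<le> \<omega>" for \<omega>
  proof -
    have "\<not> eigenvalue (cmat A) (\<i> * complex_of_real \<omega>)"
    proof
      assume "eigenvalue (cmat A) (\<i> * complex_of_real \<omega>)"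
      with hurw obtain t where "\<omega> < t" "\<not> eigenvalue (cmat A) (\<i> * complex_of_real t)"
          "\<not> strict_contraction (cmat A) M (\<i> * complex_of_real t)"
        by (rule eigenvalue_nearby_gain)
      moreover from this(1) have "0 \<le> t" using that by linarith
      ultimately show False
        using gain strict_contraction_iff_gain by blast
    qed
    thus ?thesis using gain that strict_contraction_iff_gain by blast
  qed
  show "\<forall>\<omega>. strict_contraction (cmat A) M (\<i> * complex_of_real \<omega>)"
  proof
    fix \<omega>
    show "strict_contraction (cmat A) M (\<i> * complex_of_real \<omega>)"
    proof (cases "0 \<le> \<omega>")
      case False
      thus ?thesis
        using strict_contraction_cnj[of A \<mu> N "\<i> * complex_of_real (- \<omega>)"] pos[of "- \<omega>"]
        unfolding M_def by simp
    qed (rule pos)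
  qed
qed

section \<open>Gain characterization of stability under unitary perturbations\<close>

theorem mainTheorem4:
  fixes a :: "'v::finite \<Rightarrow> 'v \<Rightarrow> real"
    and A :: "real ^ 'n ^ 'n"
    and B :: "real ^ 'm ^ 'n"
    and K :: "real ^ 'n ^ 'm"
    and c :: real
    and l :: "nat \<Rightarrow> complex"
  assumes weights: "\<And>i k. 0 \<le> a i k"
    and strong: "strongly_connected a"
    and tree: "\<exists>T. directed_spanning_tree T a"
    and spectrum: "eigenvalue_list (laplacian a) l" "l 1 = 0"
    and stabilizable: "stabilizable A B"
    and gain: "hurwitz (cmat (A - B ** K))"
    and nominal: "\<And>p. p \<in> {2..CARD('v)} \<Longrightarrow>
      hurwitz (cmat A - mat (complex_of_real c * l p) ** cmat B ** cmat K)"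
  shows "stable_under_unitary_phase A B K c CARD('v) l \<longleftrightarrow>
    (\<forall>p\<in>{2..CARD('v)}. \<forall>\<omega>::real. 0 \<le> \<omega> \<longrightarrow>
       largest_singular_value (loop_tf A B K c (l p) (\<i> * complex_of_real \<omega>)) < 1)"
proof -
  define M where "M = (\<lambda>p. mat (complex_of_real c * l p) ** cmat (B ** K))"
  have cmat_BK: "cmat (B ** K) = cmat B ** cmat K"
    by (simp add: vec_eq_iff matrix_matrix_mult_def)
  have M: "M p = mat (complex_of_real c * l p) ** cmat B ** cmat K" for p
    by (simp add: M_def cmat_BK matrix_mul_assoc)
  have "cmat B ** (mat x ** cmat K) = mat x ** cmat (B ** K)" for x
    unfolding cmat_BK
    by (simp add: vec_eq_iff mat_mult_nth)
      (simp add: matrix_matrix_mult_def[of "cmat B"] mat_mult_nth sum_distrib_left mult.left_commute)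
  hence loop: "loop_tf A B K c (l p) s = matrix_inv (mat s - cmat A) ** M p" for p s
    by (simp add: loop_tf_def M_def matrix_mul_assoc[symmetric])
  have closed: "closed_loop A B K c (l p) D = cmat A - M p ** D" for p D
    by (simp add: closed_loop_def M)
  have nominal_M: "hurwitz (cmat A - M p)" if "p \<in> {2..CARD('v)}" for p
    using nominal[OF that] by (simp add: M)
  have single: "(\<forall>D. unitary D \<longrightarrow> hurwitz (cmat A - M p ** D)) \<longleftrightarrow>
      (\<forall>\<omega>\<ge>0. largest_singular_value (loop_tf A B K c (l p) (\<i> * complex_of_real \<omega>)) < 1)"
    if p: "p \<in> {2..CARD('v)}" for p
  proof -
    have "(\<forall>D. unitary D \<longrightarrow> hurwitz (cmat A - M p ** D)) \<longleftrightarrow>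
        (\<forall>\<omega>. strict_contraction (cmat A) (M p) (\<i> * complex_of_real \<omega>))"
      using hurwitz_unitary_feedback[OF nominal_M[OF p]]
        destabilizing_unitary_feedback[OF nominal_M[OF p]] by metis
    also have "\<dots> \<longleftrightarrow>
        (\<forall>\<omega>\<ge>0. largest_singular_value (loop_tf A B K c (l p) (\<i> * complex_of_real \<omega>)) < 1)"
      using nominal_M[OF p] strict_contraction_axis_iff_gain unfolding loop M_def by blast
    finally show ?thesis .
  qed
  have "stable_under_unitary_phase A B K c CARD('v) l \<longleftrightarrow>
      (\<forall>p\<in>{2..CARD('v)}. \<forall>D. unitary D \<longrightarrow> hurwitz (cmat A - M p ** D))"
    (is "?L \<longleftrightarrow> ?R")
  proof
    assume L: ?L
    show ?R
    proof (intro ballI allI impI)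
      fix p and D :: "complex ^ 'n ^ 'n"
      assume "p \<in> {2..CARD('v)}" "unitary D"
      thus "hurwitz (cmat A - M p ** D)"
        using L[unfolded stable_under_unitary_phase_def, rule_format, of "\<lambda>_. D"]
        by (simp add: mas_stable_def closed)
    qed
  qed (auto simp: stable_under_unitary_phase_def mas_stable_def closed)
  thus ?thesis using single by simp
qed

end
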